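(* Let $p>2$ be a constant and $\varepsilon\in(0,1)$. Suppose that a randomized algorithm solves the $\ell_p$ regression problem up to a relative error of $(1+\varepsilon/3)$, i.e., given any $A\in\mathbb R^{n\times d}$ and query access to any $b\in\mathbb R^n$ it outputs $\tilde x$ with $$\|A\tilde x-b\|_p^p\le(1+\varepsilon/3)\min_{x\in\mathbb R^d}\|Ax-b\|_p^p$$ with probability at least $0.99$, and that it queries $m$ entries of $b$ in expectation. Then $m=\Omega(d^{p/2}/\varepsilon^{p-1})$.
   Context: Active $\ell_p$ regression: the design matrix $A$ is fully known to the algorithm, while each entry of the target vector $b$ read counts as one query. The lower bound is worst case over instances with $d$ columns ($n$ may be chosen as a function of $d,\varepsilon,p$); $m$ is the worst-case expected number of queries. The constant in $\Omega(\cdot)$ may depend on $p$. *)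

theory Defs
  imports "HOL-Probability.Probability" "Jordan_Normal_Form.Matrix"
begin

definition lp_norm :: "real \<Rightarrow> real vec \<Rightarrow> real" where
  "lp_norm p v = (\<Sum>i<dim_vec v. \<bar>v $ i\<bar> powr p) powr (1 / p)"

definition lp_loss :: "real \<Rightarrow> real mat \<Rightarrow> real vec \<Rightarrow> real vec \<Rightarrow> real" where
  "lp_loss p A b x = lp_norm p (A *\<^sub>v x - b) powr p"

definition lp_opt :: "real \<Rightarrow> real mat \<Rightarrow> real vec \<Rightarrow> real" where
  "lp_opt p A b = (INF x\<in>carrier_vec (dim_col A). lp_loss p A b x)"

text \<open>
  A deterministic adaptive algorithm with query access to \<open>b\<close> is a decision tree: a node
  \<open>Query i k\<close> reads the entry \<open>b $ i\<close> and continues with \<open>k (b $ i)\<close>. Branches may be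
  arbitrary functions of the values read, so there is no restriction on the computation
  done between queries.
\<close>

datatype query_tree = Output "real vec" | Query nat "real \<Rightarrow> query_tree"

primrec tree_output :: "query_tree \<Rightarrow> real vec \<Rightarrow> real vec" where
  "tree_output (Output x) b = x"
| "tree_output (Query i k) b = tree_output (k (b $ i)) b"

text \<open>
  The entries of \<open>b\<close> that are read. This is a set, so reading an entry again is free.
\<close>

primrec queried :: "query_tree \<Rightarrow> real vec \<Rightarrow> nat set" where
  "queried (Output x) b = {}"
| "queried (Query i k) b = insert i (queried (k (b $ i)) b)"

primrec well_formed :: "nat \<Rightarrow> nat \<Rightarrow> query_tree \<Rightarrow> bool" where
  "well_formed n d (Output x) \<longleftrightarrow> x \<in> carrier_vec d"
| "well_formed n d (Query i k) \<longleftrightarrow> i < n \<and> (\<forall>r. well_formed n d (k r))"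

text \<open>
  A randomized algorithm for \<open>n \<times> d\<close> instances is, for each design matrix \<open>A\<close> (which it knows
  completely), a probability distribution over decision trees. The sigma-algebra on trees is
  left arbitrary, subject only to the output and the set of entries read being random
  variables for every fixed \<open>b\<close>. This loses no generality over algorithms given by a random
  seed: the distribution of the tree determined by the seed can be taken on the largest
  sigma-algebra making the map from seeds to trees measurable.
\<close>

definition randomized_algorithm :: "nat \<Rightarrow> nat \<Rightarrow> (real mat \<Rightarrow> query_tree measure) \<Rightarrow> bool" where
  "randomized_algorithm n d alg \<longleftrightarrow>
     (\<forall>A\<in>carrier_mat n d.
        prob_space (alg A) \<and>
        (\<forall>T\<in>space (alg A). well_formed n d T) \<and>
        (\<forall>b\<in>carrier_vec n.
           (\<forall>j<d. (\<lambda>T. tree_output T b $ j) \<in> borel_measurable (alg A)) \<and>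
           (\<forall>i<n. {T \<in> space (alg A). i \<in> queried T b} \<in> sets (alg A))))"

definition solves_lp_regression ::
    "real \<Rightarrow> real \<Rightarrow> real \<Rightarrow> nat \<Rightarrow> nat \<Rightarrow> (real mat \<Rightarrow> query_tree measure) \<Rightarrow> bool" where
  "solves_lp_regression p \<kappa> q n d alg \<longleftrightarrow>
     (\<forall>A\<in>carrier_mat n d. \<forall>b\<in>carrier_vec n.
        measure (alg A)
          {T \<in> space (alg A). lp_loss p A b (tree_output T b) \<le> \<kappa> * lp_opt p A b} \<ge> q)"

definition expected_queries :: "query_tree measure \<Rightarrow> real vec \<Rightarrow> ennreal" where
  "expected_queries M b = (\<integral>\<^sup>+ T. of_nat (card (queried T b)) \<partial>M)"

definition worst_case_queries :: "nat \<Rightarrow> nat \<Rightarrow> (real mat \<Rightarrow> query_tree measure) \<Rightarrow> ennreal" where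
  "worst_case_queries n d alg =
     (SUP A\<in>carrier_mat n d. SUP b\<in>carrier_vec n. expected_queries (alg A) b)"

end

theory Submission
  imports Defs
begin

text \<open>
  The hard matrix consists of about \<open>d powr (p / 2)\<close> sign vectors whose pairwise inner products
  have typical size \<open>sqrt d\<close>, each repeated about \<open>1 / \<epsilon> powr (p - 1)\<close> times. Every row then has
  \<open>\<ell>\<^sub>p\<close> sensitivity of order \<open>\<epsilon> powr (p - 1)\<close>, so a spike of height 1 in any single entry of \<open>b\<close>
  can be fitted with loss \<open>1 - 2 * \<epsilon> / 3\<close>, which rules out outputs with \<open>A x = 0\<close>. For \<open>b = 0\<close>,
  however, only such outputs are correct, hence the algorithm has to look for the spike and reads
  each entry with constant probability.
\<close>

section \<open>Query trees, the loss, and the reduction to spikes\<close>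

lemma queried_subset: "well_formed n d T \<Longrightarrow> queried T b \<subseteq> {..<n}"
  by (induction T) auto

text \<open>The path through a tree is determined by the values read along it. This carries a run on
  \<open>b = 0\<close> over to a spike that the run does not read.\<close>

lemma tree_output_cong:
  "(\<And>i. i \<in> queried T b \<Longrightarrow> b $ i = b' $ i) \<Longrightarrow> tree_output T b = tree_output T b'"
  by (induction T) auto

lemma lp_loss_eq_sum:
  assumes "p \<noteq> 0" "A \<in> carrier_mat n d" "b \<in> carrier_vec n"
  shows "lp_loss p A b x = (\<Sum>i<n. \<bar>row A i \<bullet> x - b $ i\<bar> powr p)"
proof -
  have "(\<Sum>i<n. \<bar>(A *\<^sub>v x - b) $ i\<bar> powr p) = (\<Sum>i<n. \<bar>row A i \<bullet> x - b $ i\<bar> powr p)"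
    using assms by (intro sum.cong) auto
  moreover have "0 \<le> (\<Sum>i<n. \<bar>row A i \<bullet> x - b $ i\<bar> powr p)"
    by (intro sum_nonneg) auto
  ultimately show ?thesis
    using assms by (simp add: lp_loss_def lp_norm_def powr_powr)
qed

lemma lp_opt_le_loss:
  assumes "x \<in> carrier_vec (dim_col A)"
  shows "lp_opt p A b \<le> lp_loss p A b x"
  unfolding lp_opt_def
  by (rule cINF_lower[OF _ assms]) (auto intro!: bdd_belowI[of _ 0] simp: lp_loss_def)

text \<open>
  On \<open>b = 0\<close> a correct output satisfies \<open>A x = 0\<close>. If entry \<open>i\<close> is not read, then the
  run on \<open>unit_vec n i\<close> is the same, and the output has loss 1 there.
\<close>

lemma query_lower_bound:
  fixes p \<kappa> q :: real
  assumes p: "p > 0" and A: "A \<in> carrier_mat n d"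
    and alg: "randomized_algorithm n d alg"
    and solves: "solves_lp_regression p \<kappa> q n d alg" and q: "q > 0"
    and hard: "\<And>i. i < n \<Longrightarrow> \<kappa> * lp_opt p A (unit_vec n i) < 1"
    and \<kappa>: "\<kappa> \<ge> 0"
  shows "ennreal ((2 * q - 1) * real n) \<le> worst_case_queries n d alg"
proof -
  define M where "M = alg A"
  define good where
    "good b = {T \<in> space M. lp_loss p A b (tree_output T b) \<le> \<kappa> * lp_opt p A b}" for b
  define Z where "Z = (0\<^sub>v n :: real vec)"
  define hit where "hit i = {T \<in> space M. i \<in> queried T Z}" for i
  have Z: "Z \<in> carrier_vec n"
    by (simp add: Z_def)
  interpret prob_space M
    using alg A by (simp add: randomized_algorithm_def M_def)
  have wf: "well_formed n d T" if "T \<in> space M" for T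
    using alg A that by (simp add: randomized_algorithm_def M_def)
  have hit_sets: "hit i \<in> sets M" if "i < n" for i
    using alg A Z that by (simp add: randomized_algorithm_def M_def hit_def)
  have prob_good: "q \<le> prob (good b)" if "b \<in> carrier_vec n" for b
    using solves A that by (simp add: solves_lp_regression_def M_def good_def)
  \<comment> \<open>A non-measurable set has \<open>measure\<close> 0 by convention, so the bound
    \<open>q > 0\<close> already forces measurability.\<close>
  have good_sets: "good b \<in> sets M" if "b \<in> carrier_vec n" for b
    using prob_good[OF that] q by (metis measure_notin_sets not_less)
  have opt0: "lp_opt p A Z \<le> 0"
  proof -
    have "lp_opt p A Z \<le> lp_loss p A Z (0\<^sub>v d)"
      using A by (intro lp_opt_le_loss) auto
    also have "\<dots> = 0"
      using p A Z by (subst lp_loss_eq_sum) (auto simp: Z_def)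
    finally show ?thesis .
  qed
  have cover: "good Z \<inter> good (unit_vec n i) \<subseteq> hit i" if i: "i < n" for i
  proof
    fix T assume T: "T \<in> good Z \<inter> good (unit_vec n i)"
    then have TM: "T \<in> space M"
      by (simp add: good_def)
    show "T \<in> hit i"
    proof (rule ccontr)
      assume "T \<notin> hit i"
      then have "i \<notin> queried T Z"
        using TM by (simp add: hit_def)
      \<comment> \<open>All reads lie below \<open>n\<close>, where \<open>unit_vec n i\<close>
        differs from \<open>Z\<close> only at \<open>i\<close>.\<close>
      then have out: "tree_output T Z = tree_output T (unit_vec n i)"
        using queried_subset[OF wf[OF TM], of Z] i
        by (intro tree_output_cong) (auto simp: Z_def)
      let ?x = "tree_output T Z"
      have "lp_loss p A Z ?x \<le> \<kappa> * lp_opt p A Z"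
        using T by (simp add: good_def)
      also have "\<dots> \<le> 0"
        using \<kappa> opt0 by (rule mult_nonneg_nonpos)
      finally have "(\<Sum>j<n. \<bar>row A j \<bullet> ?x\<bar> powr p) \<le> 0"
        using p A Z by (simp add: lp_loss_eq_sum Z_def)
      then have "\<forall>j\<in>{..<n}. \<bar>row A j \<bullet> ?x\<bar> powr p = 0"
        by (subst sum_nonneg_eq_0_iff[symmetric]) (auto intro!: antisym sum_nonneg)
      then have zero: "row A j \<bullet> ?x = 0" if "j < n" for j
        using that by auto
      have "lp_loss p A (unit_vec n i) ?x = (\<Sum>j<n. \<bar>row A j \<bullet> ?x - unit_vec n i $ j\<bar> powr p)"
        using p A by (intro lp_loss_eq_sum) auto
      also have "\<dots> = (\<Sum>j<n. if j = i then 1 else 0)"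
        using i zero by (intro sum.cong) auto
      also have "\<dots> = 1"
        using i by simp
      finally have "lp_loss p A (unit_vec n i) ?x = 1" .
      moreover have "lp_loss p A (unit_vec n i) ?x \<le> \<kappa> * lp_opt p A (unit_vec n i)"
        using T out by (simp add: good_def)
      ultimately show False
        using hard[OF i] by simp
    qed
  qed
  \<comment> \<open>Each of the two events fails with probability at most \<open>1 - q\<close>, so
    both hold with probability at least \<open>2 * q - 1\<close>.\<close>
  have prob_hit: "2 * q - 1 \<le> prob (hit i)" if i: "i < n" for i
  proof -
    let ?E = "good (unit_vec n i)"
    have E: "?E \<in> sets M" "q \<le> prob ?E"
      using good_sets prob_good by auto
    have "prob (good Z \<union> ?E) = prob (good Z) + prob ?E - prob (good Z \<inter> ?E)"
      using E good_sets[OF Z] by (intro measure_Un3) (auto simp: fmeasurable_eq_sets)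
    moreover have "prob (good Z \<union> ?E) \<le> 1"
      by simp
    moreover have "prob (good Z \<inter> ?E) \<le> prob (hit i)"
      using cover[OF i] hit_sets[OF i] by (rule finite_measure_mono)
    ultimately show ?thesis
      using E prob_good[OF Z] by linarith
  qed
  \<comment> \<open>Linearity of expectation on the single target \<open>Z\<close>; the spikes
    served only to bound each \<open>prob (hit i)\<close>.\<close>
  have "ennreal ((2 * q - 1) * real n) \<le> ennreal (\<Sum>i<n. prob (hit i))"
    using sum_mono[of "{..<n}" "\<lambda>_. 2 * q - 1" "\<lambda>i. prob (hit i)"] prob_hit
    by (intro ennreal_leI) (simp add: mult.commute)
  also have "\<dots> = (\<Sum>i<n. emeasure M (hit i))"
    by (simp add: emeasure_eq_measure)
  also have "\<dots> = (\<Sum>i<n. \<integral>\<^sup>+T. indicator (hit i) T \<partial>M)"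
    using hit_sets by (intro sum.cong) auto
  also have "\<dots> = (\<integral>\<^sup>+T. (\<Sum>i<n. indicator (hit i) T) \<partial>M)"
    using hit_sets by (intro nn_integral_sum[symmetric]) auto
  also have "\<dots> = (\<integral>\<^sup>+T. of_nat (card (queried T Z)) \<partial>M)"
  proof (rule nn_integral_cong)
    fix T assume T: "T \<in> space M"
    have "(\<Sum>i<n. indicator (hit i) T :: ennreal) = (\<Sum>i<n. indicator (queried T Z) i)"
      using T by (intro sum.cong) (auto simp: hit_def indicator_def)
    also have "\<dots> = of_nat (card ({..<n} \<inter> queried T Z))"
      by (simp add: indicator_def of_bool_def flip: sum.inter_restrict)
    also have "{..<n} \<inter> queried T Z = queried T Z"
      using queried_subset[OF wf[OF T]] by auto
    finally show "(\<Sum>i<n. indicator (hit i) T :: ennreal) = of_nat (card (queried T Z))" .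
  qed
  also have "\<dots> = expected_queries (alg A) Z"
    by (simp add: expected_queries_def M_def)
  also have "\<dots> \<le> worst_case_queries n d alg"
    unfolding worst_case_queries_def using A Z by (intro SUP_upper2[of A] SUP_upper) auto
  finally show ?thesis .
qed

section \<open>Moments of inner products of sign vectors\<close>

text \<open>This trades powers for exponentials, whose sums over sign vectors factor. It is
  \<open>t \<le> exp t\<close> at \<open>t = \<bar>u\<bar> / p\<close>, raised to the power
  \<open>p\<close>.\<close>

lemma powr_le_exp_abs:
  fixes p u :: real
  assumes "p > 0"
  shows "\<bar>u\<bar> powr p \<le> p powr p * (exp u + exp (- u))"
proof -
  have "\<bar>u\<bar> / p \<le> exp (\<bar>u\<bar> / p)"
    using exp_ge_add_one_self[of "\<bar>u\<bar> / p"] by linarith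
  then have "(\<bar>u\<bar> / p) powr p \<le> exp (\<bar>u\<bar> / p) powr p"
    using assms by (intro powr_mono2) auto
  also have "\<dots> = exp \<bar>u\<bar>"
    using assms by (simp add: powr_def)
  also have "\<dots> \<le> exp u + exp (- u)"
    by (cases "u \<ge> 0") auto
  finally show ?thesis
    using assms by (simp add: powr_divide field_simps)
qed

text \<open>The linear terms cancel between \<open>exp h \<le> 1 + h + h\<^sup>2\<close> and
  \<open>exp (- h) \<le> 1 - h + h\<^sup>2\<close>. Only a quadratic term survives, which is what
  permits taking a \<open>d\<close>-th power at \<open>h = 1 / sqrt d\<close>.\<close>

lemma exp_plus_exp_minus_le:
  fixes h :: real
  assumes "0 \<le> h" "h \<le> 1"
  shows "exp h + exp (- h) \<le> 2 * (1 + h\<^sup>2)"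
proof -
  have "(1 + h) * exp (- h) \<le> 1"
    using exp_ge_add_one_self[of h] by (simp add: exp_minus field_simps)
  then have "exp (- h) \<le> 1 / (1 + h)"
    using assms by (simp add: field_simps)
  also have "\<dots> \<le> 1 - h + h\<^sup>2"
    using assms by (simp add: field_simps power2_eq_square)
  finally show ?thesis
    using exp_bound[OF assms] by (simp add: algebra_simps)
qed

text \<open>Extensional functions make the set finite and let a sum of products over it factor by
  coordinates.\<close>

definition sign_vecs :: "nat \<Rightarrow> (nat \<Rightarrow> real) set" where
  "sign_vecs d = {..<d} \<rightarrow>\<^sub>E {-1, 1}"

definition inner_upto :: "nat \<Rightarrow> (nat \<Rightarrow> real) \<Rightarrow> (nat \<Rightarrow> real) \<Rightarrow> real" where
  "inner_upto d s t = (\<Sum>c<d. s c * t c)"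

lemma finite_sign_vecs: "finite (sign_vecs d)"
  unfolding sign_vecs_def by (intro finite_PiE) auto

lemma card_sign_vecs: "card (sign_vecs d) = 2 ^ d"
  unfolding sign_vecs_def by (simp add: card_PiE numeral_2_eq_2)

lemma inner_upto_self: "a \<in> sign_vecs d \<Longrightarrow> inner_upto d a a = real d"
proof -
  assume "a \<in> sign_vecs d"
  then have "(\<Sum>c<d. a c * a c) = (\<Sum>c<d. 1)"
    by (intro sum.cong) (auto simp: sign_vecs_def PiE_def Pi_def)
  then show ?thesis
    by (simp add: inner_upto_def)
qed

text \<open>Up to the factor \<open>2 ^ d\<close> this is the moment generating function of a sum of
  \<open>d\<close> independent signs: the signs of \<open>a\<close> only permute the two terms of
  each factor.\<close>

lemma sum_exp_inner_sign_vecs: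
  assumes "a \<in> sign_vecs d"
  shows "(\<Sum>s\<in>sign_vecs d. exp (h * inner_upto d s a)) = (exp h + exp (- h)) ^ d"
proof -
  have "(\<Sum>s\<in>sign_vecs d. exp (h * inner_upto d s a)) =
      (\<Sum>s\<in>sign_vecs d. \<Prod>c<d. exp (h * (s c * a c)))"
    by (simp add: inner_upto_def sum_distrib_left exp_sum)
  also have "\<dots> = (\<Prod>c<d. \<Sum>\<sigma>\<in>{-1, 1}. exp (h * (\<sigma> * a c)))"
    unfolding sign_vecs_def by (rule prod_sum_PiE[symmetric]) auto
  also have "\<dots> = (\<Prod>c<d. exp h + exp (- h))"
  proof (rule prod.cong)
    fix c assume "c \<in> {..<d}"
    then have "a c = -1 \<or> a c = 1"
      using assms by (auto simp: sign_vecs_def PiE_def Pi_def)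
    then show "(\<Sum>\<sigma>\<in>{-1, 1}. exp (h * (\<sigma> * a c))) = exp h + exp (- h)"
      by auto
  qed simp
  finally show ?thesis
    by simp
qed

text \<open>The upper Khintchine inequality, by exponential moments at scale \<open>1 / sqrt d\<close>.\<close>

lemma sum_inner_powr_sign_vecs_le:
  fixes p :: real
  assumes p: "p > 0" and d: "d \<ge> 1" and a: "a \<in> sign_vecs d"
  shows "(\<Sum>s\<in>sign_vecs d. \<bar>inner_upto d s a\<bar> powr p)
    \<le> card (sign_vecs d) * (2 * exp 1 * p powr p * real d powr (p / 2))"
proof -
  \<comment> \<open>This scale keeps \<open>(1 + h\<^sup>2) ^ d\<close> at most
    \<open>exp 1\<close>, and \<open>h powr p\<close> cancels
    \<open>real d powr (p / 2)\<close>.\<close>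
  define h where "h = 1 / sqrt (real d)"
  have h: "0 < h" "h \<le> 1" and h2: "h\<^sup>2 = 1 / d"
    using d by (auto simp: h_def power_divide)
  have "(exp h + exp (- h)) ^ d \<le> (2 * (1 + h\<^sup>2)) ^ d"
    using h by (intro power_mono exp_plus_exp_minus_le) auto
  also have "\<dots> = 2 ^ d * (1 + 1 / d) ^ d"
    by (simp only: h2 power_mult_distrib)
  also have "\<dots> \<le> 2 ^ d * exp (1 / d) ^ d"
    by (intro mult_left_mono power_mono) auto
  also have "exp (1 / real d) ^ d = exp 1"
    using d by (simp flip: exp_of_nat_mult)
  finally have moment: "(exp h + exp (- h)) ^ d \<le> 2 ^ d * exp 1" .
  have pos: "h powr p * real d powr (p / 2) = 1"
    using d p by (simp add: h_def powr_divide powr_half_sqrt[symmetric] powr_powr)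
  have "(\<Sum>s\<in>sign_vecs d. \<bar>inner_upto d s a\<bar> powr p) =
      (\<Sum>s\<in>sign_vecs d. real d powr (p / 2) * \<bar>h * inner_upto d s a\<bar> powr p)"
    using h pos by (intro sum.cong) (simp_all add: abs_mult powr_mult mult.assoc[symmetric] mult.commute)
  also have "\<dots> \<le> (\<Sum>s\<in>sign_vecs d. real d powr (p / 2) *
      (p powr p * (exp (h * inner_upto d s a) + exp (- (h * inner_upto d s a)))))"
    by (intro sum_mono mult_left_mono powr_le_exp_abs p) auto
  also have "\<dots> = real d powr (p / 2) * p powr p *
      ((\<Sum>s\<in>sign_vecs d. exp (h * inner_upto d s a)) +
       (\<Sum>s\<in>sign_vecs d. exp ((- h) * inner_upto d s a)))"
    by (simp add: sum_distrib_left sum.distrib algebra_simps)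
  also have "\<dots> = real d powr (p / 2) * p powr p * (2 * (exp h + exp (- h)) ^ d)"
    using sum_exp_inner_sign_vecs[OF a, of h] sum_exp_inner_sign_vecs[OF a, of "- h"]
    by (simp add: add.commute)
  also have "\<dots> \<le> real d powr (p / 2) * p powr p * (2 * (2 ^ d * exp 1))"
    using moment by (intro mult_left_mono) auto
  finally show ?thesis
    by (simp add: card_sign_vecs mult_ac)
qed

section \<open>Selecting points with small pairwise weights\<close>

text \<open>Greedy choice: averaged over \<open>s\<close>, the weight towards the \<open>N\<close>
  points chosen so far is at most \<open>N * M\<close>, so some \<open>s\<close> achieves this.
  Points may repeat; a repetition is charged \<open>w a a\<close>, which the average
  includes.\<close>

lemma exists_small_pair_sum:
  fixes w :: "'a \<Rightarrow> 'a \<Rightarrow> real"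
  assumes S: "finite S" "S \<noteq> {}"
    and avg: "\<And>a. a \<in> S \<Longrightarrow> (\<Sum>s\<in>S. w s a) \<le> real (card S) * M"
  shows "\<exists>f. (\<forall>i<N. f i \<in> S) \<and>
    (\<Sum>k<N. \<Sum>i<k. w (f k) (f i)) \<le> (\<Sum>k<N. real k * M)"
proof (induction N)
  case 0
  show ?case by simp
next
  case (Suc N)
  then obtain f where f: "\<forall>i<N. f i \<in> S"
    "(\<Sum>k<N. \<Sum>i<k. w (f k) (f i)) \<le> (\<Sum>k<N. real k * M)"
    by blast
  have "\<exists>s\<in>S. (\<Sum>i<N. w s (f i)) \<le> real N * M"
  proof (rule ccontr)
    assume "\<not> (\<exists>s\<in>S. (\<Sum>i<N. w s (f i)) \<le> real N * M)"
    then have "(\<Sum>s\<in>S. real N * M) < (\<Sum>s\<in>S. \<Sum>i<N. w s (f i))"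
      using S by (intro sum_strict_mono) auto
    also have "\<dots> = (\<Sum>i<N. \<Sum>s\<in>S. w s (f i))"
      by (rule sum.swap)
    also have "\<dots> \<le> (\<Sum>i<N. real (card S) * M)"
      using f avg by (intro sum_mono) auto
    finally show False
      by simp
  qed
  then obtain s where s: "s \<in> S" "(\<Sum>i<N. w s (f i)) \<le> real N * M"
    by blast
  have "(\<Sum>k<N. \<Sum>i<k. w ((f(N := s)) k) ((f(N := s)) i)) = (\<Sum>k<N. \<Sum>i<k. w (f k) (f i))"
    by (intro sum.cong) auto
  moreover have "(\<Sum>i<N. w s ((f(N := s)) i)) = (\<Sum>i<N. w s (f i))"
    by (intro sum.cong) auto
  ultimately show ?case
    using f s by (intro exI[of _ "f(N := s)"]) (auto simp: less_Suc_eq)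
qed

text \<open>Each unordered pair of distinct indices occurs in exactly two rows. This turns the
  greedy bound on pairs into one on row sums.\<close>

lemma sum_off_diagonal_symmetric:
  fixes g :: "nat \<Rightarrow> nat \<Rightarrow> real"
  assumes sym: "\<And>i j. g i j = g j i"
  shows "(\<Sum>i<N. \<Sum>j\<in>{..<N} - {i}. g i j) = 2 * (\<Sum>k<N. \<Sum>i<k. g k i)"
proof (induction N)
  case (Suc N)
  have "(\<Sum>j\<in>{..<Suc N} - {i}. g i j) = (\<Sum>j\<in>{..<N} - {i}. g i j) + g i N" if "i < N" for i
  proof -
    have "{..<Suc N} - {i} = insert N ({..<N} - {i})"
      using that by auto
    then show ?thesis
      by simp
  qed
  moreover have "{..<Suc N} - {N} = {..<N}"
    by auto
  ultimately have "(\<Sum>i<Suc N. \<Sum>j\<in>{..<Suc N} - {i}. g i j) =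
      (\<Sum>i<N. \<Sum>j\<in>{..<N} - {i}. g i j) + (\<Sum>i<N. g i N) + (\<Sum>i<N. g N i)"
    by (simp add: sum.distrib)
  also have "(\<Sum>i<N. g i N) = (\<Sum>i<N. g N i)"
    by (intro sum.cong sym refl)
  finally show ?case
    using Suc by simp
qed simp

text \<open>
  Averaging produces \<open>2 * N - 1\<close> points with small total weight, and by Markov's inequality at
  least \<open>N\<close> of them have small individual weight.
\<close>

lemma exists_small_row_sums:
  fixes w :: "'a \<Rightarrow> 'a \<Rightarrow> real"
  assumes S: "finite S" "S \<noteq> {}"
    and avg: "\<And>a. a \<in> S \<Longrightarrow> (\<Sum>s\<in>S. w s a) \<le> real (card S) * M"
    and sym: "\<And>a b. w a b = w b a" and nonneg: "\<And>a b. w a b \<ge> 0"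
    and M: "M \<ge> 0" and N: "N \<ge> 1"
  shows "\<exists>f. (\<forall>i<N. f i \<in> S) \<and>
    (\<forall>i<N. (\<Sum>j\<in>{..<N} - {i}. w (f i) (f j)) \<le> 4 * real (N - 1) * M)"
proof -
  define L where "L = 2 * N - 1"
  obtain f where f: "\<forall>i<L. f i \<in> S"
    "(\<Sum>k<L. \<Sum>i<k. w (f k) (f i)) \<le> (\<Sum>k<L. real k * M)"
    using exists_small_pair_sum[of S w M L] S avg by blast
  define R where "R i = (\<Sum>j\<in>{..<L} - {i}. w (f i) (f j))" for i
  define B where "B = {i. i < L \<and> 4 * real (N - 1) * M < R i}"
  define G where "G = {i. i < L \<and> R i \<le> 4 * real (N - 1) * M}"
  have fin: "finite B" "finite G"
    by (auto simp: B_def G_def)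
  have gauss: "2 * (\<Sum>k<m. real k) = real m * (real m - 1)" for m
    by (induction m) (auto simp: algebra_simps)
  have RL: "real L = 2 * real N - 1"
    using N by (simp add: L_def of_nat_diff)
  have "(\<Sum>i<L. R i) = 2 * (\<Sum>k<L. \<Sum>i<k. w (f k) (f i))"
    unfolding R_def by (rule sum_off_diagonal_symmetric) (rule sym)
  also have "\<dots> \<le> (2 * (\<Sum>k<L. real k)) * M"
    using f(2) by (simp add: sum_distrib_right)
  also have "\<dots> = (2 * real N - 1) * (2 * real N - 2) * M"
    by (simp only: gauss RL) simp
  \<comment> \<open>By \<open>2 * N - 1 \<le> 2 * N\<close> the total is at most \<open>N\<close>
    times the threshold, so \<open>N\<close> rows cannot all exceed it. The factor
    \<open>N - 1\<close> makes the threshold 0 for a single point, which later admits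
    \<open>N = 1\<close> for small \<open>d\<close>.\<close>
  also have "\<dots> \<le> real N * (4 * real (N - 1) * M)"
  proof -
    have "(2 * real N - 1) * (2 * real N - 2) \<le> real N * (4 * real (N - 1))"
      using N by (simp add: of_nat_diff algebra_simps)
    from mult_right_mono[OF this M] show ?thesis
      by (simp add: mult_ac)
  qed
  finally have total: "(\<Sum>i<L. R i) \<le> real N * (4 * real (N - 1) * M)" .
  have "card B < N"
  proof (rule ccontr)
    assume B: "\<not> card B < N"
    then have "B \<noteq> {}"
      using N by auto
    have "real N * (4 * real (N - 1) * M) \<le> real (card B) * (4 * real (N - 1) * M)"
      using B M by (intro mult_right_mono) auto
    also have "\<dots> = (\<Sum>i\<in>B. 4 * real (N - 1) * M)"
      by simp
    also have "\<dots> < (\<Sum>i\<in>B. R i)"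
      using fin \<open>B \<noteq> {}\<close> by (intro sum_strict_mono) (auto simp: B_def)
    also have "\<dots> \<le> (\<Sum>i<L. R i)"
      using nonneg by (intro sum_mono2) (auto simp: B_def R_def intro!: sum_nonneg)
    finally show False
      using total by simp
  qed
  moreover have "card G + card B = L"
  proof -
    have "G \<union> B = {..<L}" "G \<inter> B = {}"
      by (auto simp: G_def B_def)
    then show ?thesis
      using card_Un_disjoint[OF fin(2,1)] by simp
  qed
  ultimately have "N \<le> card G"
    using N by (simp add: L_def)
  then obtain \<pi> where \<pi>: "inj_on \<pi> {..<N}" "\<pi> ` {..<N} \<subseteq> G"
    using card_le_inj[of "{..<N}" G] fin by auto
  have "(\<Sum>j\<in>{..<N} - {i}. w (f (\<pi> i)) (f (\<pi> j))) \<le> 4 * real (N - 1) * M" if i: "i < N" for i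
  proof -
    have "(\<Sum>j\<in>{..<N} - {i}. w (f (\<pi> i)) (f (\<pi> j))) =
        (\<Sum>j\<in>\<pi> ` ({..<N} - {i}). w (f (\<pi> i)) (f j))"
      using \<pi> by (subst sum.reindex) (auto intro: inj_on_subset)
    \<comment> \<open>Discarding points only removes nonnegative terms from a row sum.\<close>
    also have "\<dots> \<le> R (\<pi> i)"
      unfolding R_def
    proof (rule sum_mono2)
      show "\<pi> ` ({..<N} - {i}) \<subseteq> {..<L} - {\<pi> i}"
        using \<pi> i by (auto simp: G_def inj_on_def)
    qed (auto intro: nonneg)
    also have "\<dots> \<le> 4 * real (N - 1) * M"
      using \<pi> i by (auto simp: G_def)
    finally show ?thesis .
  qed
  then show ?thesis
    using f(1) \<pi>(2) by (intro exI[of _ "f \<circ> \<pi>"]) (auto simp: G_def)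
qed

section \<open>The matrix of repeated rows\<close>

lemma sum_div_eq:
  fixes g :: "nat \<Rightarrow> real"
  assumes "k > 0"
  shows "(\<Sum>r<N * k. g (r div k)) = real k * (\<Sum>i<N. g i)"
proof -
  have "(\<Sum>r<N * k. g (r div k)) = (\<Sum>i<N. \<Sum>r\<in>{i * k..<i * k + k}. g (r div k))"
    by (rule sum.nat_group[symmetric])
  also have "\<dots> = (\<Sum>i<N. \<Sum>r\<in>{i * k..<i * k + k}. g i)"
  proof (intro sum.cong refl)
    fix i r assume "r \<in> {i * k..<i * k + k}"
    then have "r div k = i"
      using assms by (intro div_nat_eqI) (auto simp: mult.commute)
    then show "g (r div k) = g i"
      by simp
  qed
  finally show ?thesis
    by (simp add: sum_distrib_left)
qed

definition row_copies_mat :: "nat \<Rightarrow> nat \<Rightarrow> nat \<Rightarrow> (nat \<Rightarrow> nat \<Rightarrow> real) \<Rightarrow> real mat" where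
  "row_copies_mat N k d f = mat (N * k) d (\<lambda>(r, c). f (r div k) c)"

text \<open>
  Upper bound by the test point \<open>(\<epsilon> / d) f\<^sub>i\<close>, where \<open>i\<close> is the block of the spike: the row of the
  spike contributes \<open>(1 - \<epsilon>)\<^sup>p\<close>, its other copies \<open>(k - 1) \<epsilon>\<^sup>p\<close>.
\<close>

lemma lp_opt_row_copies_mat_le:
  fixes p \<epsilon> \<delta> :: real
  assumes p: "p \<ge> 1" and d: "d \<ge> 1" and \<epsilon>: "0 < \<epsilon>" "\<epsilon> < 1"
    and f: "\<And>i. i < N \<Longrightarrow> f i \<in> sign_vecs d"
    and off: "\<And>i. i < N \<Longrightarrow>
      (\<Sum>j\<in>{..<N} - {i}. \<bar>inner_upto d (f i) (f j)\<bar> powr p) \<le> \<delta> * real d powr p"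
    and k: "k \<ge> 1" and r: "r < N * k"
  shows "lp_opt p (row_copies_mat N k d f) (unit_vec (N * k) r)
    \<le> 1 - \<epsilon> + \<epsilon> powr p * (real k * (1 + \<delta>) - 1)"
proof -
  define A where "A = row_copies_mat N k d f"
  define i where "i = r div k"
  define x where "x = vec d (\<lambda>c. \<epsilon> / d * f i c)"
  define g where "g j = \<bar>\<epsilon> / d * inner_upto d (f i) (f j)\<bar> powr p" for j
  have i: "i < N"
    using r by (simp add: i_def less_mult_imp_div_less)
  have A: "A \<in> carrier_mat (N * k) d"
    by (simp add: A_def row_copies_mat_def)
  have row: "row A j \<bullet> x = \<epsilon> / d * inner_upto d (f i) (f (j div k))" if "j < N * k" for j
    using that
    by (simp add: A_def row_copies_mat_def x_def scalar_prod_def inner_upto_def sum_distrib_left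
        lessThan_atLeast0 mult_ac)
  have gi: "g i = \<epsilon> powr p"
    using d \<epsilon> f[OF i] by (simp add: g_def inner_upto_self)
  have "(\<Sum>j\<in>{..<N} - {i}. g j) =
      (\<epsilon> / d) powr p * (\<Sum>j\<in>{..<N} - {i}. \<bar>inner_upto d (f i) (f j)\<bar> powr p)"
    using \<epsilon> by (simp add: g_def sum_distrib_left abs_mult flip: powr_mult)
  also have "\<dots> \<le> (\<epsilon> / d) powr p * (\<delta> * real d powr p)"
    using off[OF i] by (intro mult_left_mono) auto
  also have "\<dots> = \<epsilon> powr p * \<delta>"
    using d \<epsilon> by (simp add: powr_divide)
  finally have sum_g: "(\<Sum>j<N. g j) \<le> \<epsilon> powr p * (1 + \<delta>)"
    using i gi by (subst sum.remove[of _ i]) (auto simp: algebra_simps)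
  have "lp_opt p A (unit_vec (N * k) r) \<le> lp_loss p A (unit_vec (N * k) r) x"
    using A by (intro lp_opt_le_loss) (auto simp: x_def)
  also have "\<dots> = (\<Sum>j<N * k. \<bar>row A j \<bullet> x - unit_vec (N * k) r $ j\<bar> powr p)"
    using A p by (intro lp_loss_eq_sum) auto
  also have "\<dots> = \<bar>\<epsilon> - 1\<bar> powr p + (\<Sum>j\<in>{..<N * k} - {r}. g (j div k))"
    using r d f[OF i] row
    by (subst sum.remove[of _ r]) (auto simp: i_def[symmetric] inner_upto_self g_def intro!: sum.cong)
  \<comment> \<open>The row of the spike is missing from its block, hence the \<open>- 1\<close> in
    the bound. It matters for \<open>\<epsilon>\<close> near 1, where later
    \<open>k = 1\<close>.\<close>
  also have "(\<Sum>j\<in>{..<N * k} - {r}. g (j div k)) = (\<Sum>j<N * k. g (j div k)) - \<epsilon> powr p"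
    using r gi by (subst sum.remove[of "{..<N * k}" r]) (auto simp: i_def)
  also have "(\<Sum>j<N * k. g (j div k)) = real k * (\<Sum>j<N. g j)"
    using k by (intro sum_div_eq) auto
  also have "\<bar>\<epsilon> - 1\<bar> powr p \<le> 1 - \<epsilon>"
    using \<epsilon> p powr_mono'[of 1 p "1 - \<epsilon>"] by simp
  also have "real k * (\<Sum>j<N. g j) \<le> real k * (\<epsilon> powr p * (1 + \<delta>))"
    using sum_g by (intro mult_left_mono) auto
  finally show ?thesis
    unfolding A_def by (simp add: algebra_simps)
qed

section \<open>Choice of parameters and the lower bound\<close>

theorem theorem13p2:
  fixes p :: real
  assumes "p > 2"
  shows "\<exists>c::real. c > 0 \<and>
    (\<forall>(d::nat) (\<epsilon>::real). d \<ge> 1 \<longrightarrow> 0 < \<epsilon> \<longrightarrow> \<epsilon> < 1 \<longrightarrow>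
      (\<exists>n::nat. \<forall>alg.
        randomized_algorithm n d alg \<longrightarrow>
        solves_lp_regression p (1 + \<epsilon> / 3) (99 / 100) n d alg \<longrightarrow>
        ennreal (c * real d powr (p / 2) / \<epsilon> powr (p - 1)) \<le> worst_case_queries n d alg))"
proof -
  define C where "C = 2 * exp 1 * p powr p"
  \<comment> \<open>\<open>98 / 100\<close> is \<open>2 * q - 1\<close> for
    \<open>q = 99 / 100\<close>; the other factors come from the lower bounds on \<open>N\<close>
    and \<open>k\<close> below.\<close>
  define c where "c = 98 / 100 * (1 / (28 * C)) * (1 / 6)"
  have C: "C > 0"
    using assms by (simp add: C_def)
  show ?thesis
  proof (intro exI[of _ c] conjI allI impI)
    show "c > 0"
      using C by (simp add: c_def)
    fix d :: nat and \<epsilon> :: real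
    assume d: "d \<ge> 1" and \<epsilon>: "0 < \<epsilon>" "\<epsilon> < 1"
    define D where "D = real d powr (p / 2)"
    define E where "E = 1 / \<epsilon> powr (p - 1)"
    \<comment> \<open>With \<open>Suc\<close> of a floor, \<open>N\<close> and \<open>k\<close> are
      positive and at least the real quantities, while \<open>N - 1\<close> and \<open>k - 1\<close>
      are at most these.\<close>
    define N where "N = Suc (nat \<lfloor>D / (28 * C)\<rfloor>)"
    define k where "k = Suc (nat \<lfloor>E / 6\<rfloor>)"
    have D: "D > 0" and DD: "D * D = real d powr p"
      using d by (auto simp: D_def simp flip: powr_add)
    have "\<epsilon> powr (p - 1) \<le> 1"
      using \<epsilon> assms by (intro powr_le1) auto
    then have E: "E \<ge> 1" and eE: "\<epsilon> powr p * E = \<epsilon>"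
      using \<epsilon> by (auto simp: E_def powr_diff)
    have N: "N \<ge> 1" "D / (28 * C) \<le> real N" "real (N - 1) \<le> D / (28 * C)"
      using C D by (auto simp: N_def) linarith
    have k: "k \<ge> 1" "E / 6 \<le> real k" "real k \<le> 1 + E / 6"
      using E by (auto simp: k_def) linarith+
    have "sign_vecs d \<noteq> {}"
      using card_sign_vecs[of d] by (metis card.empty power_not_zero zero_neq_numeral)
    \<comment> \<open>The Khintchine bound supplies the mean weight \<open>C * D\<close>.\<close>
    then obtain f where f: "\<forall>i<N. f i \<in> sign_vecs d"
      "\<forall>i<N. (\<Sum>j\<in>{..<N} - {i}. \<bar>inner_upto d (f i) (f j)\<bar> powr p) \<le> 4 * real (N - 1) * (C * D)"
      using exists_small_row_sums[of "sign_vecs d" "\<lambda>s t. \<bar>inner_upto d s t\<bar> powr p" "C * D" N]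
        sum_inner_powr_sign_vecs_le[of p d] finite_sign_vecs[of d] assms d C D N(1)
      by (auto simp: inner_upto_def mult.commute C_def D_def)
    \<comment> \<open>This fixes the size of \<open>N\<close>: a pair costs \<open>C * D\<close> on
      average and the budget is a fraction of \<open>D * D\<close>. Here \<open>28 = 4 * 7\<close>
      leaves \<open>\<delta> = 1 / 7\<close>.\<close>
    have "4 * real (N - 1) * (C * D) \<le> 4 * (D / (28 * C)) * (C * D)"
      using N C D by (intro mult_right_mono mult_left_mono) auto
    also have "\<dots> = 1 / 7 * real d powr p"
      using C DD by (simp add: field_simps)
    finally have off: "4 * real (N - 1) * (C * D) \<le> 1 / 7 * real d powr p" .
    define A where "A = row_copies_mat N k d f"
    have A: "A \<in> carrier_mat (N * k) d"
      by (simp add: A_def row_copies_mat_def)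
    have hard: "(1 + \<epsilon> / 3) * lp_opt p A (unit_vec (N * k) r) < 1" if r: "r < N * k" for r
    proof -
      have "lp_opt p A (unit_vec (N * k) r)
          \<le> 1 - \<epsilon> + \<epsilon> powr p * (real k * (1 + 1 / 7) - 1)"
        unfolding A_def using assms d \<epsilon> f off k(1) r
        by (intro lp_opt_row_copies_mat_le) (auto intro: order_trans)
      \<comment> \<open>From \<open>k \<le> 1 + E / 6\<close> the bracket is at most
        \<open>1 / 7 + 4 * E / 21\<close>, and \<open>E \<ge> 1\<close> makes this at most
        \<open>E / 3\<close>.\<close>
      also have "\<epsilon> powr p * (real k * (1 + 1 / 7) - 1) \<le> \<epsilon> powr p * (E / 3)"
        using k E by (intro mult_left_mono) auto
      also have "\<dots> = \<epsilon> / 3"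
        using eE by simp
      finally have "(1 + \<epsilon> / 3) * lp_opt p A (unit_vec (N * k) r)
          \<le> (1 + \<epsilon> / 3) * (1 - \<epsilon> + \<epsilon> / 3)"
        using \<epsilon> by (intro mult_left_mono) auto
      \<comment> \<open>The product equals
        \<open>1 - \<epsilon> / 3 - 2 * \<epsilon>\<^sup>2 / 9\<close>.\<close>
      also have "\<dots> < 1"
        using \<epsilon> by (simp add: algebra_simps add_pos_pos)
      finally show ?thesis .
    qed
    have "c * D / \<epsilon> powr (p - 1) = 98 / 100 * (D / (28 * C) * (E / 6))"
      by (simp add: c_def E_def)
    also have "\<dots> \<le> 98 / 100 * (real N * real k)"
      using N k C D E by (intro mult_left_mono mult_mono) auto
    finally have count: "c * D / \<epsilon> powr (p - 1) \<le> (2 * (99 / 100) - 1) * real (N * k)"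
      by simp
    show "\<exists>n. \<forall>alg. randomized_algorithm n d alg \<longrightarrow>
        solves_lp_regression p (1 + \<epsilon> / 3) (99 / 100) n d alg \<longrightarrow>
        ennreal (c * real d powr (p / 2) / \<epsilon> powr (p - 1)) \<le> worst_case_queries n d alg"
    proof (intro exI[of _ "N * k"] allI impI)
      fix alg
      assume "randomized_algorithm (N * k) d alg"
        and "solves_lp_regression p (1 + \<epsilon> / 3) (99 / 100) (N * k) d alg"
      then have "ennreal ((2 * (99 / 100) - 1) * real (N * k)) \<le> worst_case_queries (N * k) d alg"
        using assms A hard \<epsilon> by (intro query_lower_bound) auto
      then show "ennreal (c * real d powr (p / 2) / \<epsilon> powr (p - 1))
          \<le> worst_case_queries (N * k) d alg"
        using ennreal_leI[OF count] by (simp only: D_def)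
    qed
  qed
qed

end
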